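(* Let $q$ be a prime power and $r\geq 1$. Let $G$ be a regular subgroup of the general affine group $GA(r,q)$, let $T$ be an automorphism of the group $G$, and let $\tau$ be the permutation of $F_q^r$ induced by $T$. Then the code $$S_{\tau}=\bigcup_{a\in F_q^r} C_a\times D_{\tau(a)}$$ is a $q$-ary propelinear perfect code of length $\frac{q^{r+1}-1}{q-1}$.
   Context: Let $n=\frac{q^r-1}{q-1}$. Let $H_C$ be an $r\times n$ matrix over $F_q$ whose columns are representatives of the $n$ distinct one-dimensional subspaces of $F_q^r$ (a parity check matrix of the $q$-ary Hamming code $C=\{x\in F_q^n: H_Cx^T={\bf 0}\}$). For $a\in F_q^r$ let $C_a=\{x\in F_q^n: H_Cx^T=a\}$. Let $D$ be the linear code of length $q^r$ whose coordinate positions are indexed by the vectors of $F_q^r$ and whose parity check matrix $H_D$ has, in the position indexed by $a$, the column $\binom{1}{a}$; i.e. $D=\{y=(y_a)_{a\in F_q^r}: \sum_a y_a=0,\ \sum_a y_a a={\bf 0}\}$. Let $e_a$ be the vector of length $q^r$ with $1$ in position $a$ and $0$ elsewhere, and $D_a=D+e_{\bf 0}-e_a$. For sets $X\subseteq F_q^n$, $Y\subseteq F_q^{q^r}$, $X\times Y=\{(x|y):x\in X,y\in Y\}$ where $|$ denotes concatenation. The general affine group $GA(r,q)$ consists of pairs $(a,M)$ with $a\in F_q^r$, $M\in GL(r,q)$, acting on column vectors by $(a,M)(b)=a+Mb$, with composition $(a,M)(b,M')=(a+Mb,MM')$. A subgroup $G$ is regular if it acts regularly on $F_q^r$; then for each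 $a\in F_q^r$ there is a unique $g_a\in G$ with $g_a({\bf 0})=a$. The permutation $\tau$ of $F_q^r$ induced by an automorphism $T$ of $G$ is defined by $g_{\tau(a)}=T(g_a)$ for all $a$. A code $S\subseteq F_q^N$ is perfect if it is a $1$-perfect code (the Hamming balls of radius $1$ around codewords partition $F_q^N$). The automorphism group of $F_q^N$ is the group of all isometries of $F_q^N$ with respect to the Hamming metric (the automorphism group of the Hamming graph $H(N,q)$); the automorphism group of a code is its setwise stabilizer in this group; a code is propelinear if its automorphism group contains a subgroup acting regularly on the codewords. *)

theory Defs
  imports "HOL-Analysis.Cartesian_Space" "HOL-Algebra.Bij" "HOL-Library.Disjoint_Sets"
begin

text \<open>Throughout, the finite field of order q is a type \<open>'a :: {field, finite}\<close> with
  \<open>CARD('a)\<close> = q, and r is \<open>CARD('r)\<close>.\<close>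

definition hamming_dist :: "'a ^ 'm \<Rightarrow> 'a ^ 'm \<Rightarrow> nat" where
  "hamming_dist x y = card {i. x $ i \<noteq> y $ i}"

definition hamming_ball :: "'a ^ 'm \<Rightarrow> nat \<Rightarrow> ('a ^ 'm) set" where
  "hamming_ball c t = {x. hamming_dist x c \<le> t}"

text \<open>Disjointness is required of the indexed family: in length 1, distinct codewords have
  the same ball of radius 1, so a partition by the set of balls would not be enough.\<close>

definition perfect_code :: "('a ^ 'm) set \<Rightarrow> bool" where
  "perfect_code S \<longleftrightarrow>
     disjoint_family_on (\<lambda>c. hamming_ball c 1) S \<and> (\<Union>c\<in>S. hamming_ball c 1) = UNIV"

definition hamming_aut :: "('a ^ 'm \<Rightarrow> 'a ^ 'm) monoid" where
  "hamming_aut = (BijGroup UNIV)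
     \<lparr>carrier := {f \<in> Bij UNIV. \<forall>x y. hamming_dist (f x) (f y) = hamming_dist x y}\<rparr>"

definition code_aut :: "('a ^ 'm) set \<Rightarrow> ('a ^ 'm \<Rightarrow> 'a ^ 'm) monoid" where
  "code_aut S = hamming_aut \<lparr>carrier := {f \<in> carrier hamming_aut. f ` S = S}\<rparr>"

definition acts_regularly_on :: "'g set \<Rightarrow> ('g \<Rightarrow> 'x \<Rightarrow> 'x) \<Rightarrow> 'x set \<Rightarrow> bool" where
  "acts_regularly_on G act X \<longleftrightarrow> (\<forall>x\<in>X. \<forall>y\<in>X. \<exists>!g. g \<in> G \<and> act g x = y)"

definition propelinear :: "('a ^ 'm) set \<Rightarrow> bool" where
  "propelinear S \<longleftrightarrow> (\<exists>P. subgroup P (code_aut S) \<and> acts_regularly_on P (\<lambda>f. f) S)"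

definition GA :: "(('a::field ^ 'r) \<times> ('a ^ 'r ^ 'r)) monoid" where
  "GA = \<lparr>carrier = {(a, M). invertible M},
         mult = (\<lambda>(a, M) (b, M'). (a + M *v b, M ** M')),
         one = (0, mat 1)\<rparr>"

definition GA_act :: "('a::field ^ 'r) \<times> ('a ^ 'r ^ 'r) \<Rightarrow> 'a ^ 'r \<Rightarrow> 'a ^ 'r" where
  "GA_act = (\<lambda>(a, M) b. a + M *v b)"

text \<open>The element \<open>g\<^sub>a\<close>; meaningful when \<open>G\<close> is regular.\<close>

definition elem_at ::
  "(('a::field ^ 'r) \<times> ('a ^ 'r ^ 'r)) set
    \<Rightarrow> 'a ^ 'r \<Rightarrow> ('a ^ 'r) \<times> ('a ^ 'r ^ 'r)" where
  "elem_at G a = (THE g. g \<in> G \<and> GA_act g 0 = a)"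

definition induced_by ::
  "(('a::field ^ 'r) \<times> ('a ^ 'r ^ 'r)) set
    \<Rightarrow> (('a ^ 'r) \<times> ('a ^ 'r ^ 'r) \<Rightarrow> ('a ^ 'r) \<times> ('a ^ 'r ^ 'r))
    \<Rightarrow> ('a ^ 'r \<Rightarrow> 'a ^ 'r) \<Rightarrow> bool" where
  "induced_by G T \<tau> \<longleftrightarrow> (\<forall>a. elem_at G (\<tau> a) = T (elem_at G a))"

text \<open>This forces the number \<open>CARD('n)\<close> of columns to be \<open>(q ^ r - 1) / (q - 1)\<close>, the number
  of one-dimensional subspaces, and all columns to be nonzero.\<close>

definition hamming_parity_check :: "'a::field ^ 'n ^ 'r \<Rightarrow> bool" where
  "hamming_parity_check H \<longleftrightarrow>
     bij_betw (\<lambda>j. vec.span {column j H}) UNIV {V. vec.subspace V \<and> vec.dim V = 1}"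

definition code_C :: "'a::field ^ 'n ^ 'r \<Rightarrow> 'a ^ 'r \<Rightarrow> ('a ^ 'n) set" where
  "code_C H a = {x. H *v x = a}"

definition code_D :: "('a::{field,finite} ^ ('a ^ 'r)) set" where
  "code_D = {y. (\<Sum>a\<in>UNIV. y $ a) = 0 \<and> (\<Sum>a\<in>UNIV. y $ a *s a) = 0}"

definition coset_D :: "'a::{field,finite} ^ 'r \<Rightarrow> ('a ^ ('a ^ 'r)) set" where
  "coset_D a = (\<lambda>d. d + axis 0 1 - axis a 1) ` code_D"

definition concat_vec :: "'a ^ 'm \<Rightarrow> 'a ^ 'k \<Rightarrow> 'a ^ ('m + 'k)" where
  "concat_vec x y = (\<chi> i. case i of Inl j \<Rightarrow> x $ j | Inr k \<Rightarrow> y $ k)"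

definition code_times :: "('a ^ 'm) set \<Rightarrow> ('a ^ 'k) set \<Rightarrow> ('a ^ ('m + 'k)) set" where
  "code_times X Y = {concat_vec x y | x y. x \<in> X \<and> y \<in> Y}"

definition code_S ::
  "'a::{field,finite} ^ 'n ^ 'r \<Rightarrow> ('a ^ 'r \<Rightarrow> 'a ^ 'r) \<Rightarrow> ('a ^ ('n + ('a ^ 'r))) set" where
  "code_S H \<tau> = (\<Union>a\<in>UNIV. code_times (code_C H a) (coset_D (\<tau> a)))"

lemma group_GA: "group (GA :: (('a::field ^ 'r) \<times> ('a ^ 'r ^ 'r)) monoid)"
proof (rule groupI)
  fix x :: "('a ^ 'r) \<times> ('a ^ 'r ^ 'r)"
  assume "x \<in> carrier GA"
  then obtain a M N where x: "x = (a, M)" and M: "M ** N = mat 1" "N ** M = mat 1"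
    by (auto simp: GA_def invertible_def)
  have "N *v (- a) + N *v a = 0"
    by (simp flip: matrix_vector_right_distrib)
  with M show "\<exists>y\<in>carrier GA. y \<otimes>\<^bsub>GA\<^esub> x = \<one>\<^bsub>GA\<^esub>"
    by (intro bexI[of _ "(N *v (- a), N)"]) (auto simp: GA_def x invertible_def)
qed (auto simp: GA_def invertible_mult invertible_def[of "mat 1"] matrix_mul_assoc matrix_vector_right_distrib
       matrix_vector_mul_assoc add.assoc)

lemma subgroup_code_aut: "subgroup (carrier (code_aut S)) (BijGroup UNIV)"
proof (rule group.subgroupI[OF group_BijGroup])
  show "carrier (code_aut S) \<subseteq> carrier (BijGroup UNIV)"
    by (auto simp: code_aut_def hamming_aut_def BijGroup_def)
  have "id \<in> carrier (code_aut S)"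
    by (auto simp: code_aut_def hamming_aut_def Bij_def)
  then show "carrier (code_aut S) \<noteq> {}" by auto
next
  fix f assume f: "f \<in> carrier (code_aut S)"
  then have bij: "bij f" and iso: "\<And>x y. hamming_dist (f x) (f y) = hamming_dist x y"
    and S: "f ` S = S"
    by (auto simp: code_aut_def hamming_aut_def Bij_def)
  have "hamming_dist (inv_into UNIV f x) (inv_into UNIV f y) = hamming_dist x y" for x y
    using iso[of "inv_into UNIV f x" "inv_into UNIV f y"] bij
    by (simp add: bij_is_surj surj_f_inv_f)
  moreover have "inv_into UNIV f ` S = S"
    by (metis S bij bij_def image_inv_f_f)
  moreover have "inv\<^bsub>BijGroup UNIV\<^esub> f = inv_into UNIV f"
    using bij by (subst inv_BijGroup) (auto simp: Bij_def restrict_def)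
  ultimately show "inv\<^bsub>BijGroup UNIV\<^esub> f \<in> carrier (code_aut S)"
    using bij by (auto simp: code_aut_def hamming_aut_def Bij_def bij_imp_bij_inv)
next
  fix f g assume "f \<in> carrier (code_aut S)" "g \<in> carrier (code_aut S)"
  moreover from this have "f \<otimes>\<^bsub>BijGroup UNIV\<^esub> g = f \<circ> g"
    by (auto simp: code_aut_def hamming_aut_def BijGroup_def compose_def)
  moreover have "(f \<circ> g) ` S = f ` (g ` S)"
    by (rule image_comp[symmetric])
  ultimately show "f \<otimes>\<^bsub>BijGroup UNIV\<^esub> g \<in> carrier (code_aut S)"
    by (simp add: code_aut_def hamming_aut_def Bij_def bij_comp del: image_comp)
qed

lemma group_code_aut: "group (code_aut S)"
  using group.subgroup_imp_group[OF group_BijGroup subgroup_code_aut, of S]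
  by (simp add: code_aut_def hamming_aut_def)

end

theory Submission imports Defs begin

text \<open>A word \<open>(x|y)\<close> lies in \<open>S\<^sub>\<tau>\<close> iff the entries of \<open>y\<close> sum to 0 and
  \<open>\<Sum>\<^sub>c y\<^sub>c c = - \<tau>(H x)\<close>. A matrix \<open>M\<close> of \<open>GL(r,q)\<close> permutes the one-dimensional subspaces, hence lifts
  to a monomial matrix \<open>L\<^sub>M\<close> with \<open>H L\<^sub>M = M H\<close>, and it permutes the coordinates of \<open>y\<close> by a
  permutation matrix \<open>Q\<^sub>M\<close>; both lifts are multiplicative. For \<open>(u|v)\<close> in \<open>S\<^sub>\<tau>\<close> and \<open>a = H u\<close>, let
  \<open>M\<close> and \<open>N\<close> be the linear parts of \<open>g\<^sub>a\<close> and \<open>g\<^bsub>\<tau>(a)\<^esub>\<close>. The isometries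
  \<open>(x|y) \<mapsto> (u + L\<^sub>M x | v + Q\<^sub>N y)\<close> preserve \<open>S\<^sub>\<tau>\<close> because
  \<open>\<tau>(g\<^sub>a(b)) = g\<^bsub>\<tau>(a)\<^esub>(\<tau>(b))\<close>, are closed under composition because \<open>g\<^bsub>g\<^sub>a(b)\<^esub> = g\<^sub>a g\<^sub>b\<close>, and exactly one
  of them maps 0 to a given codeword.\<close>

section \<open>Hamming distance\<close>

lemma hamming_dist_commute: "hamming_dist x y = hamming_dist y x"
  unfolding hamming_dist_def by (rule arg_cong[where f = card]) auto

lemma hamming_dist_add_left [simp]: "hamming_dist (u + x) (u + y) = hamming_dist x y"
  for x :: "'a::group_add ^ 'm"
  by (simp add: hamming_dist_def)

lemma hamming_dist_eq_0_iff [simp]: "hamming_dist x y = 0 \<longleftrightarrow> x = y"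
  by (auto simp: hamming_dist_def vec_eq_iff)

lemma hamming_dist_self [simp]: "hamming_dist x x = 0"
  by simp

lemma hamming_dist_le_1_iff: "hamming_dist x y \<le> 1 \<longleftrightarrow> (\<exists>i c. x = y + axis i c)"
  for x :: "'a::ab_group_add ^ 'm"
proof
  assume *: "hamming_dist x y \<le> 1"
  obtain i where i: "j = i" if "x $ j \<noteq> y $ j" for j
    using * by (simp add: hamming_dist_def card_le_Suc0_iff_eq) metis
  then have "x = y + axis i (x $ i - y $ i)"
    by (auto simp: vec_eq_iff axis_def)
  then show "\<exists>i c. x = y + axis i c" by blast
next
  assume "\<exists>i c. x = y + axis i c"
  then obtain i c where "x = y + axis i c" by blast
  then have "{j. x $ j \<noteq> y $ j} \<subseteq> {i}" by (auto simp: axis_def)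
  from card_mono[OF _ this] show "hamming_dist x y \<le> 1" by (simp add: hamming_dist_def)
qed

lemma hamming_dist_0_le_1_iff: "hamming_dist x 0 \<le> 1 \<longleftrightarrow> (\<exists>i c. x = axis i c)"
  for x :: "'a::ab_group_add ^ 'm"
  unfolding hamming_dist_le_1_iff by simp

lemma hamming_dist_concat:
  "hamming_dist (concat_vec x y) (concat_vec x' y') = hamming_dist x x' + hamming_dist y y'"
proof -
  have "{i. concat_vec x y $ i \<noteq> concat_vec x' y' $ i} =
      Inl ` {i. x $ i \<noteq> x' $ i} \<union> Inr ` {i. y $ i \<noteq> y' $ i}"
  proof (rule Set.set_eqI)
    fix i
    show "i \<in> {i. concat_vec x y $ i \<noteq> concat_vec x' y' $ i} \<longleftrightarrow>
        i \<in> Inl ` {i. x $ i \<noteq> x' $ i} \<union> Inr ` {i. y $ i \<noteq> y' $ i}"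
      by (cases i) (auto simp: concat_vec_def)
  qed
  then show ?thesis
    by (simp add: hamming_dist_def) (subst card_Un_disjoint; auto simp: card_image)
qed

lemma concat_vec_inject [simp]: "concat_vec x y = concat_vec x' y' \<longleftrightarrow> x = x' \<and> y = y'"
proof
  assume "concat_vec x y = concat_vec x' y'"
  then have "hamming_dist x x' + hamming_dist y y' = 0"
    by (simp flip: hamming_dist_concat)
  then show "x = x' \<and> y = y'" by simp
qed simp

lemma concat_vec_cases: obtains x y where "w = concat_vec x y"
proof
  show "w = concat_vec (\<chi> i. w $ Inl i) (\<chi> i. w $ Inr i)"
    by (auto simp: concat_vec_def vec_eq_iff split: sum.splits)
qed

text \<open>Disjoint balls leave at most one codeword within distance 1 of a word; covering provides
  one. Perfection thus becomes unique decoding.\<close>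

lemma perfect_code_iff: "perfect_code S \<longleftrightarrow> (\<forall>w. \<exists>!c. c \<in> S \<and> hamming_dist w c \<le> 1)"
proof -
  have "disjoint_family_on (\<lambda>c. hamming_ball c 1) S \<longleftrightarrow>
      (\<forall>w. \<forall>c\<in>S. \<forall>c'\<in>S. hamming_dist w c \<le> 1 \<longrightarrow> hamming_dist w c' \<le> 1 \<longrightarrow> c = c')"
    unfolding disjoint_family_on_def hamming_ball_def by blast
  moreover have "(\<Union>c\<in>S. hamming_ball c 1) = UNIV \<longleftrightarrow> (\<forall>w. \<exists>c\<in>S. hamming_dist w c \<le> 1)"
    unfolding hamming_ball_def by blast
  moreover have "(\<exists>!c. c \<in> S \<and> hamming_dist w c \<le> 1) \<longleftrightarrow>
      (\<forall>c\<in>S. \<forall>c'\<in>S. hamming_dist w c \<le> 1 \<longrightarrow> hamming_dist w c' \<le> 1 \<longrightarrow> c = c') \<and>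
      (\<exists>c\<in>S. hamming_dist w c \<le> 1)" for w
    by blast
  ultimately show ?thesis by (simp only: perfect_code_def all_conj_distrib)
qed

section \<open>A criterion for propelinearity\<close>

text \<open>The regular group consists of the maps \<open>\<phi> s\<close> with \<open>s\<close> in
  \<open>S\<close>; by \<open>base\<close>, \<open>s\<close> is recovered as the image of
  \<open>z\<close>. Inverses come from finiteness: an injective map of \<open>S\<close> into itself
  is onto.\<close>

lemma propelinearI:
  fixes \<phi> :: "'a::finite ^ 'm \<Rightarrow> 'a ^ 'm \<Rightarrow> 'a ^ 'm"
  assumes z: "z \<in> S"
    and iso: "\<And>s x y. s \<in> S \<Longrightarrow> hamming_dist (\<phi> s x) (\<phi> s y) = hamming_dist x y"
    and closed: "\<And>s t. s \<in> S \<Longrightarrow> t \<in> S \<Longrightarrow> \<phi> s t \<in> S"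
    and base: "\<And>s. s \<in> S \<Longrightarrow> \<phi> s z = s"
    and comp: "\<And>s t w. s \<in> S \<Longrightarrow> t \<in> S \<Longrightarrow> \<phi> s (\<phi> t w) = \<phi> (\<phi> s t) w"
  shows "propelinear S"
proof -
  have inj: "inj (\<phi> s)" if "s \<in> S" for s
    using iso[OF that] by (metis hamming_dist_eq_0_iff injI)
  have bij: "bij (\<phi> s)" if "s \<in> S" for s
    using inj[OF that] by (simp add: bij_def finite_UNIV_inj_surj)
  have img: "\<phi> s ` S = S" if "s \<in> S" for s
    using closed[OF that] inj[OF that]
    by (intro endo_inj_surj) (auto simp: inj_on_def)
  have mult: "f \<otimes>\<^bsub>code_aut S\<^esub> g = f \<circ> g" if "f \<in> Bij UNIV" "g \<in> Bij UNIV" for f g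
    using that by (auto simp: code_aut_def hamming_aut_def BijGroup_def compose_def)
  have one: "\<one>\<^bsub>code_aut S\<^esub> = id"
    by (auto simp: code_aut_def hamming_aut_def BijGroup_def)
  have Bij: "\<phi> s \<in> Bij UNIV" if "s \<in> S" for s
    using bij[OF that] by (simp add: Bij_def)
  have aut: "\<phi> s \<in> carrier (code_aut S)" if "s \<in> S" for s
    using Bij[OF that] img[OF that] iso[OF that] by (auto simp: code_aut_def hamming_aut_def)
  \<comment> \<open>By \<open>comp\<close> and \<open>base\<close> the map \<open>\<phi> z\<close>
    is idempotent, and an injective idempotent is the identity.\<close>
  have phi_z: "\<phi> z = id"
    using comp[OF z z] base[OF z] inj[OF z] by (auto simp: inj_def fun_eq_iff)
  have inverse: "\<exists>t\<in>S. \<phi> t \<circ> \<phi> s = id \<and> \<phi> s \<circ> \<phi> t = id" if s: "s \<in> S" for s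
  proof -
    obtain t where t: "t \<in> S" "\<phi> s t = z" using img[OF s] z by (metis imageE)
    have right: "\<phi> s (\<phi> t w) = w" for w
      using comp[OF s t(1)] t(2) phi_z by simp
    have "\<phi> t (\<phi> s w) = w" for w
      using right[of "\<phi> s w"] inj[OF s] by (auto simp: inj_def)
    with right t(1) show ?thesis by (auto simp: fun_eq_iff)
  qed
  have "subgroup (\<phi> ` S) (code_aut S)"
  proof (rule group.subgroupI[OF group_code_aut])
    show "\<phi> ` S \<subseteq> carrier (code_aut S)" using aut by blast
    show "\<phi> ` S \<noteq> {}" using z by blast
  next
    fix f assume "f \<in> \<phi> ` S"
    then obtain s where s: "s \<in> S" "f = \<phi> s" by blast
    obtain t where t: "t \<in> S" "\<phi> t \<circ> \<phi> s = id" using inverse[OF s(1)] by blast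
    then have "\<phi> t \<otimes>\<^bsub>code_aut S\<^esub> \<phi> s = \<one>\<^bsub>code_aut S\<^esub>"
      using s(1) by (simp add: mult Bij one)
    then have "inv\<^bsub>code_aut S\<^esub> (\<phi> s) = \<phi> t"
      using aut s(1) t(1) by (intro group.inv_equality[OF group_code_aut]) auto
    then show "inv\<^bsub>code_aut S\<^esub> f \<in> \<phi> ` S" using s t by simp
  next
    fix f g assume "f \<in> \<phi> ` S" "g \<in> \<phi> ` S"
    then obtain s t where st: "s \<in> S" "f = \<phi> s" "t \<in> S" "g = \<phi> t" by blast
    then have "f \<otimes>\<^bsub>code_aut S\<^esub> g = \<phi> (\<phi> s t)"
      using mult[OF Bij Bij, of s t] comp[of s t] by auto
    then show "f \<otimes>\<^bsub>code_aut S\<^esub> g \<in> \<phi> ` S" using closed st by simp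
  qed
  moreover have "\<exists>!f. f \<in> \<phi> ` S \<and> f x = y" if x: "x \<in> S" and y: "y \<in> S" for x y
  proof -
    obtain t where t: "t \<in> S" "\<phi> t \<circ> \<phi> x = id" "\<phi> x \<circ> \<phi> t = id"
      using inverse[OF x] by blast
    have tx: "\<phi> t x = z"
      using t(2) base[OF x] by (metis comp_apply id_apply)
    show ?thesis
    proof (rule ex1I)
      \<comment> \<open>The witness passes through the base point: \<open>\<phi> t\<close> takes
        \<open>x\<close> to \<open>z\<close>, then \<open>\<phi> y\<close> takes \<open>z\<close> to
        \<open>y\<close>.\<close>
      have "\<phi> (\<phi> y t) x = y"
        using comp[OF y t(1), of x] tx base[OF y] by simp
      then show "\<phi> (\<phi> y t) \<in> \<phi> ` S \<and> \<phi> (\<phi> y t) x = y"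
        using closed[OF y t(1)] by blast
    next
      fix f assume f: "f \<in> \<phi> ` S \<and> f x = y"
      then obtain s where s: "s \<in> S" "f = \<phi> s" "\<phi> s x = y" by blast
      have "\<phi> s w = \<phi> (\<phi> y t) w" for w
      proof -
        have "\<phi> s w = \<phi> s (\<phi> x (\<phi> t w))" using t(3) by (metis comp_apply id_apply)
        also have "\<dots> = \<phi> y (\<phi> t w)" using comp[OF s(1) x] s(3) by simp
        also have "\<dots> = \<phi> (\<phi> y t) w" using comp[OF y t(1)] by simp
        finally show ?thesis .
      qed
      then show "f = \<phi> (\<phi> y t)" using s by blast
    qed
  qed
  ultimately show ?thesis
    unfolding propelinear_def acts_regularly_on_def by blast
qed

section \<open>Matrices inducing isometries\<close>

lemma matrix_vector_mult_axis: "A *v axis j c = c *s column j A"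
  for A :: "'a::field ^ 'n ^ 'm"
  by (simp add: vec_eq_iff matrix_vector_mult_def axis_def column_def if_distrib mult.commute
      cong: if_cong)

lemma matrix_eq_columnI:
  fixes A B :: "'a::field ^ 'n ^ 'm"
  assumes "\<And>j. column j A = column j B"
  shows "A = B"
  using assms by (simp add: vec_eq_iff column_def)

lemma column_matrix_mult: "column j (A ** B) = A *v column j B"
  for A :: "'a::field ^ 'n ^ 'm"
  by (simp add: vec_eq_iff column_def matrix_matrix_mult_def matrix_vector_mult_def)

text \<open>Each column has at most one nonzero entry, so changing one input coordinate affects at
  most one output coordinate; a union bound finishes.\<close>

lemma hamming_dist_matrix_le:
  fixes A :: "'a::field ^ 'n ^ 'm"
  assumes "\<And>j. hamming_dist (column j A) 0 \<le> 1"
  shows "hamming_dist (A *v x) (A *v y) \<le> hamming_dist x y"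
proof -
  let ?J = "{j. x $ j \<noteq> y $ j}"
  have "{i. (A *v x) $ i \<noteq> (A *v y) $ i} \<subseteq> (\<Union>j\<in>?J. {i. column j A $ i \<noteq> 0 $ i})"
  proof
    fix i assume i: "i \<in> {i. (A *v x) $ i \<noteq> (A *v y) $ i}"
    have "\<exists>j. A $ i $ j * x $ j \<noteq> A $ i $ j * y $ j"
    proof (rule ccontr)
      assume "\<nexists>j. A $ i $ j * x $ j \<noteq> A $ i $ j * y $ j"
      then have "(A *v x) $ i = (A *v y) $ i"
        unfolding matrix_vector_mult_def vec_lambda_beta by (intro sum.cong) blast+
      with i show False by simp
    qed
    then show "i \<in> (\<Union>j\<in>?J. {i. column j A $ i \<noteq> 0 $ i})" by (auto simp: column_def)
  qed
  then have "hamming_dist (A *v x) (A *v y) \<le> card (\<Union>j\<in>?J. {i. column j A $ i \<noteq> 0 $ i})"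
    unfolding hamming_dist_def by (intro card_mono) auto
  also have "\<dots> \<le> (\<Sum>j\<in>?J. hamming_dist (column j A) 0)"
    unfolding hamming_dist_def by (rule card_UN_le) simp
  also have "\<dots> \<le> (\<Sum>j\<in>?J. 1)" by (rule sum_mono) (rule assms)
  finally show ?thesis by (simp add: hamming_dist_def)
qed

text \<open>The left inverse \<open>B\<close> is equally sparse and gives the reverse
  inequality.\<close>

lemma hamming_dist_matrix:
  fixes A B :: "'a::field ^ 'n ^ 'n"
  assumes "\<And>j. hamming_dist (column j A) 0 \<le> 1" "\<And>j. hamming_dist (column j B) 0 \<le> 1"
    and "B ** A = mat 1"
  shows "hamming_dist (A *v x) (A *v y) = hamming_dist x y"
proof (rule antisym)
  show "hamming_dist (A *v x) (A *v y) \<le> hamming_dist x y"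
    by (rule hamming_dist_matrix_le) (rule assms)
  have "hamming_dist (B *v (A *v x)) (B *v (A *v y)) \<le> hamming_dist (A *v x) (A *v y)"
    by (rule hamming_dist_matrix_le) (rule assms)
  then show "hamming_dist x y \<le> hamming_dist (A *v x) (A *v y)"
    by (simp add: matrix_vector_mul_assoc assms(3))
qed

section \<open>The Hamming code\<close>

text \<open>For a Hamming parity check \<open>H\<close> the description by \<open>THE\<close> is
  proper, because the Hamming code is perfect; see \<open>ex1_coset_leader\<close>.\<close>

definition coset_leader :: "'a::field ^ 'n ^ 'r \<Rightarrow> 'a ^ 'r \<Rightarrow> 'a ^ 'n" where
  "coset_leader H d = (THE e. hamming_dist e 0 \<le> 1 \<and> H *v e = d)"

text \<open>For a Hamming parity check \<open>H\<close>, the vector \<open>M *v column j H\<close>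
  is a multiple \<open>c\<close> of some column \<open>i\<close>, and column \<open>j\<close> of the
  lift is \<open>axis i c\<close>. Coset leaders supply \<open>i\<close> and \<open>c\<close>
  without a choice.\<close>

definition monomial_lift :: "'a::field ^ 'n ^ 'r \<Rightarrow> 'a ^ 'r ^ 'r \<Rightarrow> 'a ^ 'n ^ 'n" where
  "monomial_lift H M = (\<chi> i j. coset_leader H (M *v column j H) $ i)"

lemma column_monomial_lift [simp]:
  "column j (monomial_lift H M) = coset_leader H (M *v column j H)"
  by (simp add: monomial_lift_def column_def vec_eq_iff)

context
  fixes H :: "'a::field ^ 'n ^ 'r"
  assumes H: "hamming_parity_check H"
begin

lemma column_parity_check_nonzero: "column j H \<noteq> 0"
proof
  assume "column j H = 0"
  moreover have "vec.dim (vec.span {column j H}) = 1"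
    using H unfolding hamming_parity_check_def bij_betw_def by blast
  ultimately show False by simp
qed

text \<open>Equal nonzero multiples give the two columns equal spans, so the indices agree; a
  nonzero column then cancels.\<close>

lemma column_parity_check_inject:
  assumes "c *s column i H = c' *s column j H" "c \<noteq> 0"
  shows "i = j \<and> c = c'"
proof -
  have c': "c' \<noteq> 0"
    using assms column_parity_check_nonzero[of i] by auto
  have eq: "column i H = (c' / c) *s column j H"
    using arg_cong[OF assms(1), of "\<lambda>v. inverse c *s v"] assms(2)
    by (simp add: vector_smult_assoc field_simps)
  have "column i H \<in> vec.span {column j H}"
    unfolding eq by (intro vec.span_scale vec.span_base) simp
  moreover have "column j H \<in> vec.span {column i H}"
  proof -
    have "column j H = (c / c') *s column i H"
      using c' assms(2) by (simp add: eq vector_smult_assoc)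
    also have "\<dots> \<in> vec.span {column i H}" by (intro vec.span_scale vec.span_base) simp
    finally show ?thesis .
  qed
  ultimately have "vec.span {column i H} = vec.span {column j H}"
    by (simp add: vec.span_eq)
  then have ij: "i = j"
    using H unfolding hamming_parity_check_def bij_betw_def inj_def by blast
  with assms column_parity_check_nonzero[of j] show ?thesis
    by (simp add: vec.scale_cancel_right)
qed

lemma multiple_of_column_parity_check:
  assumes "d \<noteq> 0"
  obtains j c where "d = c *s column j H"
proof -
  have "vec.span {d} \<in> {V. vec.subspace V \<and> vec.dim V = 1}"
    using assms by simp
  then obtain j where "vec.span {d} = vec.span {column j H}"
    using H unfolding hamming_parity_check_def bij_betw_def by blast
  then have "d \<in> vec.span {column j H}"
    using vec.span_base[of d "{d}"] by simp
  then show ?thesis using that by (auto simp: vec.span_singleton)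
qed

lemma ex1_coset_leader: "\<exists>!e. hamming_dist e 0 \<le> 1 \<and> H *v e = d"
proof (rule ex_ex1I)
  show "\<exists>e. hamming_dist e 0 \<le> 1 \<and> H *v e = d"
  proof (cases "d = 0")
    case True
    then show ?thesis by (intro exI[of _ 0]) (simp add: hamming_dist_def)
  next
    case False
    then obtain j c where "d = c *s column j H" by (rule multiple_of_column_parity_check)
    then show ?thesis
      by (intro exI[of _ "axis j c"])
        (auto simp: hamming_dist_0_le_1_iff[unfolded One_nat_def] matrix_vector_mult_axis)
  qed
next
  fix e e' assume *: "hamming_dist e 0 \<le> 1 \<and> H *v e = d" "hamming_dist e' 0 \<le> 1 \<and> H *v e' = d"
  obtain i c j c' where e: "e = axis i c" "e' = axis j c'"
    using * unfolding hamming_dist_0_le_1_iff by blast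
  have "c *s column i H = c' *s column j H" using * by (simp add: e matrix_vector_mult_axis)
  \<comment> \<open>\<open>column_parity_check_inject\<close> wants a nonzero left scalar, hence
    both orientations; if both scalars vanish, both words are 0.\<close>
  then show "e = e'"
    using column_parity_check_inject[of c i c' j] column_parity_check_inject[of c' j c i]
    by (cases "c = 0"; cases "c' = 0") (auto simp: e axis_eq_axis)
qed

lemma coset_leader: "hamming_dist (coset_leader H d) 0 \<le> 1" "H *v coset_leader H d = d"
  using theI'[OF ex1_coset_leader, of d] unfolding coset_leader_def by blast+

lemma coset_leader_eqI: "hamming_dist e 0 \<le> 1 \<Longrightarrow> H *v e = d \<Longrightarrow> coset_leader H d = e"
  unfolding coset_leader_def using ex1_coset_leader[of d] by (intro the1_equality) auto

text \<open>Syndrome decoding: the correction to \<open>x\<close> must be the coset leader of the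
  missing syndrome \<open>d - H *v x\<close>. Hence every coset of the Hamming code is
  perfect.\<close>

lemma ex1_near_with_syndrome: "\<exists>!x'. hamming_dist x x' \<le> 1 \<and> H *v x' = d"
proof -
  have dist: "hamming_dist x x' = hamming_dist (x' - x) 0" for x'
    using hamming_dist_add_left[of x "x' - x" 0] by (simp add: hamming_dist_commute)
  show ?thesis
  proof (rule ex1I)
    show "hamming_dist x (x + coset_leader H (d - H *v x)) \<le> 1 \<and>
        H *v (x + coset_leader H (d - H *v x)) = d"
      using coset_leader[of "d - H *v x"] by (simp add: dist matrix_vector_right_distrib)
  next
    fix x' assume "hamming_dist x x' \<le> 1 \<and> H *v x' = d"
    then have "coset_leader H (d - H *v x) = x' - x"
      by (intro coset_leader_eqI) (simp_all add: dist matrix_vector_mult_diff_distrib)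
    then show "x' = x + coset_leader H (d - H *v x)" by simp
  qed
qed

text \<open>The definition fixes the lift on unit vectors. Every leader is a multiple of one, so
  linearity extends the rule to all leaders; multiplicativity of the lift rests on this.\<close>

lemma monomial_lift_coset_leader:
  "monomial_lift H M *v coset_leader H d = coset_leader H (M *v d)"
proof -
  obtain j c where e: "coset_leader H d = axis j c"
    using coset_leader(1)[of d] unfolding hamming_dist_0_le_1_iff by blast
  obtain i b where l: "coset_leader H (M *v column j H) = axis i b"
    using coset_leader(1)[of "M *v column j H"] unfolding hamming_dist_0_le_1_iff by blast
  have d: "d = c *s column j H"
    using coset_leader(2)[of d] by (simp add: e matrix_vector_mult_axis)
  have "coset_leader H (M *v d) = c *s axis i b"
  proof (rule coset_leader_eqI)
    have "c *s axis i b = axis i (c * b)" by (simp add: vec_eq_iff axis_def)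
    then show "hamming_dist (c *s axis i b) 0 \<le> 1" unfolding hamming_dist_0_le_1_iff by blast
    show "H *v (c *s axis i b) = M *v d"
      using coset_leader(2)[of "M *v column j H"] by (simp add: l d vector_scalar_commute)
  qed
  then show ?thesis by (simp add: e matrix_vector_mult_axis l)
qed

lemma parity_check_monomial_lift: "H ** monomial_lift H M = M ** H"
  by (rule matrix_eq_columnI) (simp add: column_matrix_mult coset_leader)

lemma monomial_lift_mult: "monomial_lift H (M ** N) = monomial_lift H M ** monomial_lift H N"
  by (rule matrix_eq_columnI)
    (simp add: column_matrix_mult monomial_lift_coset_leader matrix_vector_mul_assoc)

lemma monomial_lift_one: "monomial_lift H (mat 1) = mat 1"
proof (rule matrix_eq_columnI)
  fix j
  have "column j (mat 1 :: 'a ^ 'n ^ 'n) = axis j 1"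
    by (auto simp: column_def mat_def axis_def vec_eq_iff)
  moreover have "coset_leader H (column j H) = axis j 1"
    by (rule coset_leader_eqI)
      (auto simp: hamming_dist_0_le_1_iff[unfolded One_nat_def] matrix_vector_mult_axis)
  ultimately show "column j (monomial_lift H (mat 1)) = column j (mat 1)" by simp
qed

lemma hamming_dist_monomial_lift:
  assumes "invertible M"
  shows "hamming_dist (monomial_lift H M *v x) (monomial_lift H M *v y) = hamming_dist x y"
proof -
  obtain N where N: "N ** M = mat 1" using assms by (auto simp: invertible_def)
  show ?thesis
  proof (rule hamming_dist_matrix)
    show "monomial_lift H N ** monomial_lift H M = mat 1"
      by (metis N monomial_lift_mult monomial_lift_one)
  qed (simp_all add: coset_leader[unfolded One_nat_def])
qed

end

text \<open>Every nonzero vector is a nonzero multiple of exactly one column, with a unique scalar;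
  count such pairs.\<close>

lemma card_parity_check_columns:
  fixes H :: "'a::{field,finite} ^ 'n ^ 'r"
  assumes "hamming_parity_check H"
  shows "CARD('n) * (CARD('a) - 1) = CARD('a) ^ CARD('r) - 1"
proof -
  have "bij_betw (\<lambda>(j, c). c *s column j H) (UNIV \<times> (UNIV - {0})) (UNIV - {0})"
    unfolding bij_betw_def
  proof
    show "inj_on (\<lambda>(j, c). c *s column j H) (UNIV \<times> (UNIV - {0}))"
      using column_parity_check_inject[OF assms] by (auto simp: inj_on_def)
    show "(\<lambda>(j, c). c *s column j H) ` (UNIV \<times> (UNIV - {0})) = UNIV - {0}"
    proof (rule equalityI; rule subsetI)
      fix d assume "d \<in> UNIV - {0 :: 'a ^ 'r}"
      then have "d \<noteq> 0" by simp
      then obtain j c where "d = c *s column j H"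
        by (rule multiple_of_column_parity_check[OF assms])
      with \<open>d \<noteq> 0\<close> show "d \<in> (\<lambda>(j, c). c *s column j H) ` (UNIV \<times> (UNIV - {0}))"
        by (intro image_eqI[of _ _ "(j, c)"]) auto
    qed (auto simp: column_parity_check_nonzero[OF assms])
  qed
  from bij_betw_same_card[OF this] show ?thesis
    by (simp add: card_cartesian_product card_Diff_singleton)
qed

lemma two_le_card_field: "2 \<le> CARD('a::{field,finite})"
proof -
  have "card {0, 1 :: 'a} \<le> CARD('a)" by (rule card_mono) auto
  then show ?thesis by simp
qed

lemma length_code_S:
  fixes H :: "'a::{field,finite} ^ 'n ^ 'r"
  assumes "hamming_parity_check H"
  shows "real CARD('n + ('a ^ 'r)) = (real CARD('a) ^ (CARD('r) + 1) - 1) / (real CARD('a) - 1)"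
proof -
  have q: "2 \<le> CARD('a)" by (rule two_le_card_field)
  \<comment> \<open>This bound lets the truncated subtraction of naturals pass to the reals.\<close>
  then have "1 \<le> CARD('a) ^ CARD('r)" by simp
  with q have "real CARD('n) * (real CARD('a) - 1) = real CARD('a) ^ CARD('r) - 1"
    using arg_cong[OF card_parity_check_columns[OF assms], of real] by (simp add: of_nat_diff)
  with q show ?thesis by (simp add: field_simps)
qed

section \<open>Coordinate permutations of the code D\<close>

text \<open>This is \<open>H_D\<close> without its top row of ones.\<close>

definition point_matrix :: "'a::{field,finite} ^ ('a ^ 'r) ^ 'r" where
  "point_matrix = (\<chi> i c. c $ i)"

text \<open>For invertible \<open>N\<close> this moves the entry at position \<open>b\<close> to
  position \<open>N *v b\<close>. As a matrix it falls under \<open>hamming_dist_matrix\<close>,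
  like the monomial lift.\<close>

definition perm_matrix :: "'a::{field,finite} ^ 'r ^ 'r \<Rightarrow> 'a ^ ('a ^ 'r) ^ ('a ^ 'r)" where
  "perm_matrix N = (\<chi> c b. if c = N *v b then 1 else 0)"

lemma column_point_matrix [simp]: "column c point_matrix = c"
  by (simp add: column_def point_matrix_def)

lemma column_perm_matrix [simp]: "column b (perm_matrix N) = axis (N *v b) 1"
  by (auto simp: column_def perm_matrix_def axis_def vec_eq_iff)

lemma point_matrix_perm_matrix: "point_matrix ** perm_matrix N = N ** point_matrix"
  by (rule matrix_eq_columnI) (simp add: column_matrix_mult matrix_vector_mult_axis)

lemma perm_matrix_mult: "perm_matrix (M ** N) = perm_matrix M ** perm_matrix N"
  by (rule matrix_eq_columnI)
    (simp add: column_matrix_mult matrix_vector_mult_axis matrix_vector_mul_assoc)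

lemma perm_matrix_one: "perm_matrix (mat 1) = mat 1"
  unfolding perm_matrix_def matrix_vector_mul_lid by (simp add: mat_def)

lemma hamming_dist_perm_matrix:
  assumes "invertible M"
  shows "hamming_dist (perm_matrix M *v x) (perm_matrix M *v y) = hamming_dist x y"
proof -
  obtain N where N: "N ** M = mat 1" using assms by (auto simp: invertible_def)
  show ?thesis
  proof (rule hamming_dist_matrix)
    show "perm_matrix N ** perm_matrix M = mat 1"
      by (metis N perm_matrix_mult perm_matrix_one)
  qed (auto simp: hamming_dist_0_le_1_iff[unfolded One_nat_def])
qed

lemma sum_perm_matrix: "(\<Sum>c\<in>UNIV. (perm_matrix N *v y) $ c) = (\<Sum>c\<in>UNIV. y $ c)"
proof -
  have "(\<Sum>c\<in>UNIV. (perm_matrix N *v y) $ c)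
      = (\<Sum>c\<in>UNIV. \<Sum>b\<in>UNIV. if c = N *v b then y $ b else 0)"
    by (simp add: matrix_vector_mult_def perm_matrix_def if_distrib if_distribR cong: if_cong)
  also have "\<dots> = (\<Sum>b\<in>UNIV. \<Sum>c\<in>UNIV. if c = N *v b then y $ b else 0)"
    by (rule sum.swap)
  finally show ?thesis by simp
qed

lemma code_D_iff: "y \<in> code_D \<longleftrightarrow> (\<Sum>c\<in>UNIV. y $ c) = 0 \<and> point_matrix *v y = 0"
  by (simp add: code_D_def matrix_mult_sum)

lemma sum_axis: "(\<Sum>c\<in>UNIV. axis i x $ c) = x"
  by (simp add: axis_def)

text \<open>The shift \<open>axis 0 1 - axis a 1\<close> has entry sum 0 and is mapped to
  \<open>- a\<close> by \<open>point_matrix\<close>, whence the minus sign.\<close>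

lemma coset_D_iff:
  "y \<in> coset_D a \<longleftrightarrow> (\<Sum>c\<in>UNIV. y $ c) = 0 \<and> point_matrix *v y = - a"
proof -
  have "y \<in> coset_D a \<longleftrightarrow> y - axis 0 1 + axis a 1 \<in> code_D"
    unfolding coset_D_def by (auto intro: image_eqI[of _ _ "y - axis 0 1 + axis a 1"])
  also have "\<dots> \<longleftrightarrow> (\<Sum>c\<in>UNIV. y $ c) = 0 \<and> point_matrix *v y + a = 0"
    by (simp add: code_D_iff sum.distrib sum_subtractf sum_axis matrix_vector_right_distrib
        matrix_vector_mult_diff_distrib matrix_vector_mult_axis)
  finally show ?thesis by (simp add: eq_neg_iff_add_eq_0)
qed

lemma concat_in_code_S_iff:
  "concat_vec x y \<in> code_S H \<tau> \<longleftrightarrow>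
    (\<Sum>c\<in>UNIV. y $ c) = 0 \<and> point_matrix *v y = - \<tau> (H *v x)"
  by (auto simp: code_S_def code_times_def code_C_def coset_D_iff)

text \<open>The check sum of \<open>y\<close> decides in which block an error occurred: an error in \<open>x\<close> is then
  located by the Hamming code, an error in \<open>y\<close> by the value of \<open>point_matrix *v y\<close>.\<close>

lemma perfect_code_S:
  fixes H :: "'a::{field,finite} ^ 'n ^ 'r"
  assumes H: "hamming_parity_check H" and "bij \<tau>"
  shows "perfect_code (code_S H \<tau>)"
  unfolding perfect_code_iff
proof
  fix w :: "'a ^ ('n + ('a ^ 'r))"
  obtain x y where w: "w = concat_vec x y" by (rule concat_vec_cases)
  define s where "s = (\<Sum>c\<in>UNIV. y $ c)"
  show "\<exists>!c. c \<in> code_S H \<tau> \<and> hamming_dist w c \<le> 1"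
  proof (cases "s = 0")
    case True
    \<comment> \<open>\<open>a\<close> is the only syndrome that the first block can have in a
      codeword with second block \<open>y\<close>, namely the preimage of
      \<open>- (point_matrix *v y)\<close> under \<open>\<tau>\<close>.\<close>
    obtain a where a: "\<And>b. point_matrix *v y = - \<tau> b \<longleftrightarrow> b = a"
    proof
      fix b
      have "point_matrix *v y = - \<tau> b \<longleftrightarrow> - (point_matrix *v y) = \<tau> b"
        by (metis minus_minus)
      then show "point_matrix *v y = - \<tau> b \<longleftrightarrow> b = inv_into UNIV \<tau> (- (point_matrix *v y))"
        using bij_inv_eq_iff[OF \<open>bij \<tau>\<close>, of b "- (point_matrix *v y)"] by auto
    qed
    obtain x' where x': "hamming_dist x x' \<le> 1" "H *v x' = a"
      and uniq: "\<And>z. hamming_dist x z \<le> 1 \<Longrightarrow> H *v z = a \<Longrightarrow> z = x'"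
      using ex1_near_with_syndrome[OF H, of x a] by blast
    show ?thesis
    proof (rule ex1I)
      show "concat_vec x' y \<in> code_S H \<tau> \<and> hamming_dist w (concat_vec x' y) \<le> 1"
        using x' True a[of a] by (simp add: concat_in_code_S_iff w hamming_dist_concat s_def)
    next
      fix c assume c: "c \<in> code_S H \<tau> \<and> hamming_dist w c \<le> 1"
      obtain z v where zv: "c = concat_vec z v" by (rule concat_vec_cases)
      have dist: "hamming_dist x z + hamming_dist y v \<le> 1"
        using c by (simp add: w zv hamming_dist_concat)
      have v: "(\<Sum>c\<in>UNIV. v $ c) = 0" "point_matrix *v v = - \<tau> (H *v z)"
        using c by (simp_all add: zv concat_in_code_S_iff)
      \<comment> \<open>An error of value \<open>b\<close> in the second block changes the check sum
        by \<open>b\<close>; both sums are 0.\<close>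
      obtain i b where "y = v + axis i b"
        using dist hamming_dist_le_1_iff[of y v] by auto
      moreover from this have "b = 0"
        using True v by (simp add: s_def sum.distrib sum_axis)
      ultimately have "v = y" by (simp add: axis_eq_0_iff)
      then have "H *v z = a" using v a by simp
      then show "c = concat_vec x' y"
        using uniq[of z] dist \<open>v = y\<close> by (simp add: zv)
    qed
  next
    case False
    \<comment> \<open>The error value is \<open>s\<close>. Subtracting it at position
      \<open>i\<close> lowers \<open>point_matrix *v y\<close> by \<open>s *s i\<close>, and the
      result has to be \<open>- \<tau> (H *v x)\<close>; solve for \<open>i\<close>.\<close>
    define i where "i = inverse s *s (point_matrix *v y + \<tau> (H *v x))"
    have i: "s *s i = point_matrix *v y + \<tau> (H *v x)"
      using False by (simp add: i_def vector_smult_assoc)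
    show ?thesis
    proof (rule ex1I)
      have "hamming_dist y (y - axis i s) \<le> 1"
        unfolding hamming_dist_le_1_iff by (intro exI[of _ i] exI[of _ s]) simp
      moreover have "(\<Sum>c\<in>UNIV. (y - axis i s) $ c) = 0"
        by (simp add: sum_subtractf sum_axis s_def)
      moreover have "point_matrix *v (y - axis i s) = - \<tau> (H *v x)"
        by (simp add: matrix_vector_mult_diff_distrib matrix_vector_mult_axis i)
      ultimately show "concat_vec x (y - axis i s) \<in> code_S H \<tau> \<and>
          hamming_dist w (concat_vec x (y - axis i s)) \<le> 1"
        unfolding concat_in_code_S_iff w hamming_dist_concat by simp
    next
      fix c assume c: "c \<in> code_S H \<tau> \<and> hamming_dist w c \<le> 1"
      obtain z v where zv: "c = concat_vec z v" by (rule concat_vec_cases)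
      have dist: "hamming_dist x z + hamming_dist y v \<le> 1"
        using c by (simp add: w zv hamming_dist_concat)
      have v: "(\<Sum>c\<in>UNIV. v $ c) = 0" "point_matrix *v v = - \<tau> (H *v z)"
        using c by (simp_all add: zv concat_in_code_S_iff)
      \<comment> \<open>The check sums differ, so the single permitted error is spent in the second
        block.\<close>
      have "y \<noteq> v" using v False by (auto simp: s_def)
      then have "hamming_dist y v \<noteq> 0" by simp
      with dist have "hamming_dist x z = 0" by linarith
      then have [simp]: "z = x" by simp
      obtain j b where y: "y = v + axis j b"
        using dist hamming_dist_le_1_iff[of y v] by auto
      have b: "b = s"
        using v by (simp add: s_def y sum.distrib sum_axis)
      have "s *s j = s *s i"
        using v(2) by (simp add: i y b matrix_vector_right_distrib matrix_vector_mult_axis)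
      then have "j = i" using False by (simp add: vec.scale_cancel_left)
      then show "c = concat_vec x (y - axis i s)" by (simp add: zv y b)
    qed
  qed
qed

section \<open>Regular subgroups of the affine group\<close>

context
  fixes G :: "(('a::field ^ 'r) \<times> ('a ^ 'r ^ 'r)) set"
  assumes G: "subgroup G GA" and reg: "acts_regularly_on G GA_act UNIV"
begin

lemma ex1_elem_at: "\<exists>!g. g \<in> G \<and> GA_act g 0 = a"
  using reg unfolding acts_regularly_on_def by blast

lemma elem_at: "elem_at G a \<in> G" "fst (elem_at G a) = a"
proof -
  have "elem_at G a \<in> G \<and> GA_act (elem_at G a) 0 = a"
    unfolding elem_at_def by (rule theI'[OF ex1_elem_at])
  then show "elem_at G a \<in> G" "fst (elem_at G a) = a"
    by (auto simp: GA_act_def split: prod.splits)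
qed

lemma elem_at_eqI: "g \<in> G \<Longrightarrow> fst g = a \<Longrightarrow> elem_at G a = g"
  unfolding elem_at_def using ex1_elem_at[of a]
  by (intro the1_equality) (auto simp: GA_act_def split: prod.splits)

lemma invertible_elem_at: "invertible (snd (elem_at G a))"
  using subgroup.subset[OF G] elem_at(1)[of a] by (auto simp: GA_def)

text \<open>The product sends 0 to \<open>g\<^sub>a(b)\<close>, and regularity admits only one such
  element.\<close>

lemma elem_at_mult:
  "elem_at G (a + snd (elem_at G a) *v b) = elem_at G a \<otimes>\<^bsub>GA\<^esub> elem_at G b"
proof (rule elem_at_eqI)
  show "elem_at G a \<otimes>\<^bsub>GA\<^esub> elem_at G b \<in> G"
    by (intro subgroup.m_closed[OF G] elem_at)
  show "fst (elem_at G a \<otimes>\<^bsub>GA\<^esub> elem_at G b) = a + snd (elem_at G a) *v b"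
    by (simp add: GA_def case_prod_beta elem_at)
qed

lemma snd_elem_at_mult:
  "snd (elem_at G (a + snd (elem_at G a) *v b)) = snd (elem_at G a) ** snd (elem_at G b)"
  unfolding elem_at_mult by (simp add: GA_def split: prod.splits)

text \<open>Apply \<open>T\<close> to \<open>elem_at_mult\<close>, use the same lemma backwards at
  \<open>\<tau> a\<close> and \<open>\<tau> b\<close>, and compare translation parts.\<close>

lemma induced_by_action:
  assumes T: "T \<in> hom (GA\<lparr>carrier := G\<rparr>) (GA\<lparr>carrier := G\<rparr>)" and ind: "induced_by G T \<tau>"
  shows "\<tau> (a + snd (elem_at G a) *v b) = \<tau> a + snd (elem_at G (\<tau> a)) *v \<tau> b"
proof -
  have "elem_at G (\<tau> (a + snd (elem_at G a) *v b)) = T (elem_at G a \<otimes>\<^bsub>GA\<^esub> elem_at G b)"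
    using ind unfolding induced_by_def by (simp add: elem_at_mult)
  also have "\<dots> = T (elem_at G a) \<otimes>\<^bsub>GA\<^esub> T (elem_at G b)"
    using hom_mult[OF T] elem_at(1) by simp
  also have "\<dots> = elem_at G (\<tau> a + snd (elem_at G (\<tau> a)) *v \<tau> b)"
    using ind unfolding induced_by_def elem_at_mult by simp
  finally show ?thesis by (metis elem_at(2))
qed

lemma induced_by_zero:
  assumes "T \<in> hom (GA\<lparr>carrier := G\<rparr>) (GA\<lparr>carrier := G\<rparr>)" "induced_by G T \<tau>"
  shows "\<tau> 0 = 0"
proof -
  obtain N where N: "N ** snd (elem_at G (\<tau> 0)) = mat 1"
    using invertible_elem_at by (auto simp: invertible_def)
  \<comment> \<open>At \<open>a = b = 0\<close> the term \<open>\<tau> 0\<close> cancels, so an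
    invertible matrix kills \<open>\<tau> 0\<close>.\<close>
  have "snd (elem_at G (\<tau> 0)) *v \<tau> 0 = 0"
    using induced_by_action[OF assms, of 0 0] by simp
  then have "N *v (snd (elem_at G (\<tau> 0)) *v \<tau> 0) = 0" by simp
  then show ?thesis by (simp add: matrix_vector_mul_assoc N)
qed

lemma inj_induced_by:
  assumes T: "inj_on T G" and ind: "induced_by G T \<tau>"
  shows "inj \<tau>"
proof (rule injI)
  fix a b assume "\<tau> a = \<tau> b"
  then have "T (elem_at G a) = T (elem_at G b)"
    using ind unfolding induced_by_def by metis
  then have "elem_at G a = elem_at G b" using T elem_at(1) by (auto dest: inj_onD)
  then show "a = b" by (metis elem_at(2))
qed

end

theorem theorem2:
  fixes H :: "'a::{field,finite} ^ 'n ^ 'r"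
    and G :: "(('a ^ 'r) \<times> ('a ^ 'r ^ 'r)) set"
    and T :: "('a ^ 'r) \<times> ('a ^ 'r ^ 'r) \<Rightarrow> ('a ^ 'r) \<times> ('a ^ 'r ^ 'r)"
    and \<tau> :: "'a ^ 'r \<Rightarrow> 'a ^ 'r"
  assumes "hamming_parity_check H"
    and "subgroup G GA"
    and "acts_regularly_on G GA_act UNIV"
    and "T \<in> iso (GA\<lparr>carrier := G\<rparr>) (GA\<lparr>carrier := G\<rparr>)"
    and "induced_by G T \<tau>"
  shows "propelinear (code_S H \<tau>) \<and> perfect_code (code_S H \<tau>) \<and>
    real CARD('n + ('a ^ 'r)) = (real CARD('a) ^ (CARD('r) + 1) - 1) / (real CARD('a) - 1)"
proof (intro conjI)
  note H = assms(1) and G = assms(2,3)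
  have T: "T \<in> hom (GA\<lparr>carrier := G\<rparr>) (GA\<lparr>carrier := G\<rparr>)" "inj_on T G"
    using assms(4) by (auto simp: iso_def bij_betw_def)
  have "inj \<tau>" by (rule inj_induced_by[OF G T(2) assms(5)])
  then have "bij \<tau>" by (simp add: bij_def finite_UNIV_inj_surj)
  with H show "perfect_code (code_S H \<tau>)" by (rule perfect_code_S)
  show "real CARD('n + ('a ^ 'r)) = (real CARD('a) ^ (CARD('r) + 1) - 1) / (real CARD('a) - 1)"
    using H by (rule length_code_S)
  define L where "L a = monomial_lift H (snd (elem_at G a))" for a
  define Q where "Q a = perm_matrix (snd (elem_at G (\<tau> a)))" for a
  \<comment> \<open>The projections make \<open>\<phi>\<close> a function of whole words, as
    \<open>propelinearI\<close> requires.\<close>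
  define lft :: "'a ^ ('n + ('a ^ 'r)) \<Rightarrow> 'a ^ 'n" where "lft w = (\<chi> i. w $ Inl i)" for w
  define rgt :: "'a ^ ('n + ('a ^ 'r)) \<Rightarrow> 'a ^ ('a ^ 'r)" where "rgt w = (\<chi> i. w $ Inr i)" for w
  have lft_concat [simp]: "lft (concat_vec x y) = x" for x y
    by (simp add: lft_def concat_vec_def vec_eq_iff)
  have rgt_concat [simp]: "rgt (concat_vec x y) = y" for x y
    by (simp add: rgt_def concat_vec_def vec_eq_iff)
  define \<phi> where "\<phi> s w = concat_vec (lft s + L (H *v lft s) *v lft w)
    (rgt s + Q (H *v lft s) *v rgt w)" for s w
  \<comment> \<open>On syndromes of the first block, the isometry acts as \<open>g\<^sub>a\<close>
    with \<open>a = H *v u\<close>.\<close>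
  have syndrome: "H *v (u + L (H *v u) *v x)
      = H *v u + snd (elem_at G (H *v u)) *v (H *v x)" for u x
    by (simp add: L_def matrix_vector_right_distrib matrix_vector_mul_assoc
        parity_check_monomial_lift[OF H])
  have L_mult: "L (H *v (u + L (H *v u) *v x)) = L (H *v u) ** L (H *v x)" for u x
    unfolding syndrome by (simp add: L_def snd_elem_at_mult[OF G] monomial_lift_mult[OF H])
  \<comment> \<open>\<open>\<tau>\<close> carries \<open>g\<^sub>a(b)\<close> to the image of
    \<open>\<tau> b\<close> under the element at \<open>\<tau> a\<close>, so the linear parts
    multiply on this side too.\<close>
  have Q_mult: "Q (H *v (u + L (H *v u) *v x)) = Q (H *v u) ** Q (H *v x)" for u x
    unfolding syndrome
    by (simp add: Q_def induced_by_action[OF G T(1) assms(5)] snd_elem_at_mult[OF G]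
        perm_matrix_mult)
  show "propelinear (code_S H \<tau>)"
  proof (rule propelinearI)
    show "concat_vec 0 0 \<in> code_S H \<tau>"
      by (simp add: concat_in_code_S_iff induced_by_zero[OF G T(1) assms(5)])
  next
    fix s x y :: "'a ^ ('n + ('a ^ 'r))"
    obtain x1 x2 y1 y2 where "x = concat_vec x1 x2" "y = concat_vec y1 y2"
      by (metis concat_vec_cases)
    then show "hamming_dist (\<phi> s x) (\<phi> s y) = hamming_dist x y"
      by (simp add: \<phi>_def hamming_dist_concat L_def Q_def hamming_dist_perm_matrix
          hamming_dist_monomial_lift[OF H] invertible_elem_at[OF G])
  next
    fix s t assume st: "s \<in> code_S H \<tau>" "t \<in> code_S H \<tau>"
    obtain u v where s: "s = concat_vec u v" by (rule concat_vec_cases)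
    obtain x y where t: "t = concat_vec x y" by (rule concat_vec_cases)
    \<comment> \<open>Relabelling the positions by a matrix applies that matrix to
      \<open>point_matrix *v y\<close>.\<close>
    have "point_matrix *v (Q (H *v u) *v y)
        = snd (elem_at G (\<tau> (H *v u))) *v (point_matrix *v y)"
      by (simp add: Q_def matrix_vector_mul_assoc point_matrix_perm_matrix)
    also have "\<dots> = - (snd (elem_at G (\<tau> (H *v u))) *v \<tau> (H *v x))"
      using st(2) by (simp add: t concat_in_code_S_iff vec.neg)
    \<comment> \<open>Adding \<open>point_matrix *v v = - \<tau> (H *v u)\<close> gives minus the
      right-hand side of \<open>induced_by_action\<close>, that is, minus \<open>\<tau>\<close> of
      the new syndrome.\<close>
    finally have "point_matrix *v (v + Q (H *v u) *v y) = - \<tau> (H *v (u + L (H *v u) *v x))"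
      using st(1) unfolding syndrome induced_by_action[OF G T(1) assms(5)]
      by (simp add: s concat_in_code_S_iff matrix_vector_right_distrib)
    moreover have "(\<Sum>c\<in>UNIV. (v + Q (H *v u) *v y) $ c) = 0"
      using st by (simp add: s t concat_in_code_S_iff sum.distrib Q_def sum_perm_matrix)
    ultimately show "\<phi> s t \<in> code_S H \<tau>"
      by (simp add: \<phi>_def s t concat_in_code_S_iff)
  next
    fix s :: "'a ^ ('n + ('a ^ 'r))"
    obtain u v where s: "s = concat_vec u v" by (rule concat_vec_cases)
    show "\<phi> s (concat_vec 0 0) = s" by (simp add: \<phi>_def s)
  next
    fix s t w
    show "\<phi> s (\<phi> t w) = \<phi> (\<phi> s t) w"
      unfolding \<phi>_def concat_vec_inject lft_concat rgt_concat L_mult Q_mult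
      by (simp add: matrix_vector_right_distrib matrix_vector_mul_assoc add.assoc)
  qed
qed

end
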